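(* Let $\mathbf P=(P,\leq,{}',0,1)$ be a poset of finite height that is both weakly orthomodular and dually weakly orthomodular and satisfies $x''=x$ for all $x\in P$, and define mappings $\odot,\rightarrow\colon P^2\rightarrow 2^P\setminus\{\emptyset\}$ by $$x\odot y:=\operatorname{Min}U(x,y')\wedge y,\qquad x\rightarrow y:=x'\vee\operatorname{Max}L(x,y)$$ for all $x,y\in P$. Then $\odot$ and $\rightarrow$ are well-defined and $\mathbb R(\mathbf P):=(P,\leq,\odot,\rightarrow,0,1)$ is an idempotent and divisible operator residuated structure satisfying the double negation law and $x\rightarrow 0=x'$ for all $x\in P$.
   Context: A complementation on a bounded poset is a unary operation $'$ with $x\vee x'=1$ and $x\wedge x'=0$ for all $x$ (not assumed antitone). A poset is of finite height if it contains no infinite chain. A weakly orthomodular poset is a bounded poset $(P,\leq,{}',0,1)$ with complementation such that $x\leq y$ implies that $x\vee(y\wedge x')$ is defined and equals $y$. A dually weakly orthomodular poset is a bounded poset $(P,\leq,{}',0,1)$ with complementation such that $x\leq y$ implies that $y\wedge(x\vee y')$ is defined and equals $x$. Set notation in a poset $(P,\le)$: for $A,B\subseteq P$, $A\leq B$ means $x\leq y$ for all $x\in A$, $y\in B$; $L(x,y)$ and $U(x,y)$ are the sets of common lower and common upper bounds of $x,y$; $\operatorname{Min}A$ and $\operatorname{Max}A$ are the sets of minimal and maximal elements of $A$. Lattice operations on sets are elementwise: $A\wedge y=\{a\wedge y\mid a\in A\}$, $x\vee A=\{x\vee a\mid a\in A\}$, etc.; such an expression is defined if all the meets or joins involved exist.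 Elements $x$ are identified with singletons $\{x\}$. For non-empty $A,B\subseteq P$: $A\sqsubseteq B$ iff there are $a\in A$ and $b\in B$ with $a\leq b$. For a mapping $\otimes\colon P^2\to 2^P$, $A\subseteq P$ and $y\in P$ put $A\otimes y:=\bigcup_{x\in A}(x\otimes y)$. An operator residuated structure is a six-tuple $(P,\leq,\odot,\rightarrow,0,1)$ such that for all $x,y,z\in P$: (i) $(P,\leq,0,1)$ is a bounded poset; (ii) $\odot$ and $\rightarrow$ are mappings from $P^2$ to $2^P\setminus\{\emptyset\}$; (iii) $x\odot y\sqsubseteq z$ if and only if $x\sqsubseteq y\rightarrow z$; (iv) $x\odot 1=1\odot x=x$; (v) $y\rightarrow 0\leq x$ implies $x\odot y=x\wedge y$ (in particular the meet exists); (vi) $y\leq x$ implies $x\rightarrow y=(x\rightarrow 0)\vee y$ (in particular the joins exist). It is idempotent if $x\odot x=x$ for all $x$; divisible if $(x\rightarrow y)\odot x=\operatorname{Max}L(x,y)$ for all $x,y$; it satisfies the double negation law if $(x\rightarrow 0)\rightarrow 0=x$ for all $x$. *)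

theory Defs
  imports Main
begin

text \<open>
  Bounded posets are types of class \<open>{order_bot, order_top}\<close>, with 0 and 1 written
  \<open>bot\<close> and \<open>top\<close>. Set-valued binary operations have type \<open>'a \<Rightarrow> 'a \<Rightarrow> 'a set\<close>.
\<close>

definition finite_height :: "'a::order itself \<Rightarrow> bool" where
  "finite_height _ \<longleftrightarrow> (\<forall>C :: 'a set. Complete_Partial_Order.chain (\<le>) C \<longrightarrow> finite C)"

definition lower_bounds :: "'a::order \<Rightarrow> 'a \<Rightarrow> 'a set" where
  "lower_bounds x y = {z. z \<le> x \<and> z \<le> y}"

definition upper_bounds :: "'a::order \<Rightarrow> 'a \<Rightarrow> 'a set" where
  "upper_bounds x y = {z. x \<le> z \<and> y \<le> z}"

definition minimal_elements :: "'a::order set \<Rightarrow> 'a set" where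
  "minimal_elements A = {m \<in> A. \<forall>a \<in> A. a \<le> m \<longrightarrow> a = m}"

definition maximal_elements :: "'a::order set \<Rightarrow> 'a set" where
  "maximal_elements A = {m \<in> A. \<forall>a \<in> A. m \<le> a \<longrightarrow> a = m}"

text \<open>
  Binary meets and joins are partial: \<open>is_meet x y z\<close> says that the meet of \<open>x\<close> and \<open>y\<close>
  exists and equals \<open>z\<close>. The total functions \<open>meet\<close> and \<open>join\<close> are unspecified where the
  meet or join does not exist, so they are always used together with \<open>has_meet\<close>, \<open>has_join\<close>
  (or their set versions).
\<close>

definition is_meet :: "'a::order \<Rightarrow> 'a \<Rightarrow> 'a \<Rightarrow> bool" where
  "is_meet x y z \<longleftrightarrow> z \<in> lower_bounds x y \<and> (\<forall>w \<in> lower_bounds x y. w \<le> z)"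

definition is_join :: "'a::order \<Rightarrow> 'a \<Rightarrow> 'a \<Rightarrow> bool" where
  "is_join x y z \<longleftrightarrow> z \<in> upper_bounds x y \<and> (\<forall>w \<in> upper_bounds x y. z \<le> w)"

definition has_meet :: "'a::order \<Rightarrow> 'a \<Rightarrow> bool" where
  "has_meet x y \<longleftrightarrow> (\<exists>z. is_meet x y z)"

definition has_join :: "'a::order \<Rightarrow> 'a \<Rightarrow> bool" where
  "has_join x y \<longleftrightarrow> (\<exists>z. is_join x y z)"

definition meet :: "'a::order \<Rightarrow> 'a \<Rightarrow> 'a" where
  "meet x y = (THE z. is_meet x y z)"

definition join :: "'a::order \<Rightarrow> 'a \<Rightarrow> 'a" where
  "join x y = (THE z. is_join x y z)"

definition set_meet_defined :: "'a::order set \<Rightarrow> 'a \<Rightarrow> bool" where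
  "set_meet_defined A y \<longleftrightarrow> (\<forall>a \<in> A. has_meet a y)"

definition set_meet :: "'a::order set \<Rightarrow> 'a \<Rightarrow> 'a set" where
  "set_meet A y = {meet a y |a. a \<in> A}"

definition join_set_defined :: "'a::order \<Rightarrow> 'a set \<Rightarrow> bool" where
  "join_set_defined x A \<longleftrightarrow> (\<forall>a \<in> A. has_join x a)"

definition join_set :: "'a::order \<Rightarrow> 'a set \<Rightarrow> 'a set" where
  "join_set x A = {join x a |a. a \<in> A}"

definition set_join_defined :: "'a::order set \<Rightarrow> 'a \<Rightarrow> bool" where
  "set_join_defined A y \<longleftrightarrow> (\<forall>a \<in> A. has_join a y)"

definition set_join :: "'a::order set \<Rightarrow> 'a \<Rightarrow> 'a set" where
  "set_join A y = {join a y |a. a \<in> A}"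

definition complementation :: "('a::{order_bot,order_top} \<Rightarrow> 'a) \<Rightarrow> bool" where
  "complementation c \<longleftrightarrow> (\<forall>x. is_join x (c x) top \<and> is_meet x (c x) bot)"

definition weakly_orthomodular :: "('a::{order_bot,order_top} \<Rightarrow> 'a) \<Rightarrow> bool" where
  "weakly_orthomodular c \<longleftrightarrow> complementation c \<and>
     (\<forall>x y. x \<le> y \<longrightarrow> has_meet y (c x) \<and> is_join x (meet y (c x)) y)"

definition dually_weakly_orthomodular :: "('a::{order_bot,order_top} \<Rightarrow> 'a) \<Rightarrow> bool" where
  "dually_weakly_orthomodular c \<longleftrightarrow> complementation c \<and>
     (\<forall>x y. x \<le> y \<longrightarrow> has_join x (c y) \<and> is_meet y (join x (c y)) x)"

text \<open>The relation \<open>\<sqsubseteq>\<close>, which is only meant for non-empty sets.\<close>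

definition sq_le :: "'a::order set \<Rightarrow> 'a set \<Rightarrow> bool" where
  "sq_le A B \<longleftrightarrow> (\<exists>a \<in> A. \<exists>b \<in> B. a \<le> b)"

definition lift_left :: "('a \<Rightarrow> 'a \<Rightarrow> 'a set) \<Rightarrow> 'a set \<Rightarrow> 'a \<Rightarrow> 'a set" where
  "lift_left f A y = (\<Union>x \<in> A. f x y)"

definition operator_residuated_structure ::
  "('a::{order_bot,order_top} \<Rightarrow> 'a \<Rightarrow> 'a set) \<Rightarrow> ('a \<Rightarrow> 'a \<Rightarrow> 'a set) \<Rightarrow> bool" where
  "operator_residuated_structure odot imp \<longleftrightarrow>
     (\<forall>x y. odot x y \<noteq> {} \<and> imp x y \<noteq> {}) \<and>
     (\<forall>x y z. sq_le (odot x y) {z} \<longleftrightarrow> sq_le {x} (imp y z)) \<and>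
     (\<forall>x. odot x top = {x} \<and> odot top x = {x}) \<and>
     (\<forall>x y. (\<forall>a \<in> imp y bot. a \<le> x) \<longrightarrow> has_meet x y \<and> odot x y = {meet x y}) \<and>
     (\<forall>x y. y \<le> x \<longrightarrow> set_join_defined (imp x bot) y \<and> imp x y = set_join (imp x bot) y)"

definition idempotent_op :: "('a \<Rightarrow> 'a \<Rightarrow> 'a set) \<Rightarrow> bool" where
  "idempotent_op odot \<longleftrightarrow> (\<forall>x. odot x x = {x})"

definition divisible ::
  "('a::order \<Rightarrow> 'a \<Rightarrow> 'a set) \<Rightarrow> ('a \<Rightarrow> 'a \<Rightarrow> 'a set) \<Rightarrow> bool" where
  "divisible odot imp \<longleftrightarrow>
     (\<forall>x y. lift_left odot (imp x y) x = maximal_elements (lower_bounds x y))"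

definition double_negation_law :: "('a::order_bot \<Rightarrow> 'a \<Rightarrow> 'a set) \<Rightarrow> bool" where
  "double_negation_law imp \<longleftrightarrow> (\<forall>x. lift_left imp (imp x bot) bot = {x})"

definition om_odot :: "('a::order \<Rightarrow> 'a) \<Rightarrow> 'a \<Rightarrow> 'a \<Rightarrow> 'a set" where
  "om_odot c x y = set_meet (minimal_elements (upper_bounds x (c y))) y"

definition om_imp :: "('a::order \<Rightarrow> 'a) \<Rightarrow> 'a \<Rightarrow> 'a \<Rightarrow> 'a set" where
  "om_imp c x y = join_set (c x) (maximal_elements (lower_bounds x y))"

text \<open>
  Well-definedness of the two operations as maps into the non-empty subsets: all meets,
  respectively joins, in the defining expression exist and the resulting set is non-empty.
\<close>

definition om_odot_well_defined :: "('a::order \<Rightarrow> 'a) \<Rightarrow> bool" where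
  "om_odot_well_defined c \<longleftrightarrow>
     (\<forall>x y. set_meet_defined (minimal_elements (upper_bounds x (c y))) y \<and> om_odot c x y \<noteq> {})"

definition om_imp_well_defined :: "('a::order \<Rightarrow> 'a) \<Rightarrow> bool" where
  "om_imp_well_defined c \<longleftrightarrow>
     (\<forall>x y. join_set_defined (c x) (maximal_elements (lower_bounds x y)) \<and> om_imp c x y \<noteq> {})"

end

(* Both orthomodularity laws say that, once one fixes y, the maps m |-> m meet y (for m above y')
   and l |-> y' join l (for l below y) are defined and mutually inverse.  Finite height
   supplies minimal elements below and maximal elements above any given element of a set;
   adjointness and divisibility then reduce to transporting elements along these two maps. *)
theory Submission
  imports Defs
begin

section \<open>Well-foundedness and extremal elements from finite height\<close>

text \<open>The range would be an infinite chain, since strict comparability of distinct indices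
  makes \<open>f\<close> injective. The disjunction lets one statement serve both descending and
  ascending sequences.\<close>

lemma finite_height_no_comparable_sequence:
  fixes f :: "nat \<Rightarrow> 'a::order"
  assumes "finite_height TYPE('a)"
    and comparable: "\<And>i j. i < j \<Longrightarrow> f i < f j \<or> f j < f i"
  shows False
proof -
  have "f i \<le> f j \<or> f j \<le> f i" for i j
    using comparable[of i j] comparable[of j i] by (cases i j rule: linorder_cases) auto
  then have "Complete_Partial_Order.chain (\<le>) (range f)"
    by (auto simp: Complete_Partial_Order.chain_def)
  moreover have "inj f"
    using comparable by (intro linorder_injI) (metis less_irrefl)
  then have "infinite (range f)"
    using finite_imageD by blast
  ultimately show False
    using assms(1) by (auto simp: finite_height_def)
qed

lemma finite_height_wf_less:
  assumes "finite_height TYPE('a::order)"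
  shows "wf {(x, y :: 'a). x < y}"
proof -
  have False if desc: "\<And>i. f (Suc i) < f i" for f :: "nat \<Rightarrow> 'a"
  proof (rule finite_height_no_comparable_sequence[OF assms])
    fix i j :: nat
    assume "i < j"
    then have "f j < f i"
      by (induction rule: less_Suc_induct) (auto intro: desc order.strict_trans)
    then show "f i < f j \<or> f j < f i" ..
  qed
  then show ?thesis
    by (auto simp: wf_iff_no_infinite_down_chain)
qed

lemma finite_height_wf_greater:
  assumes "finite_height TYPE('a::order)"
  shows "wf {(x, y :: 'a). y < x}"
proof -
  have False if asc: "\<And>i. f i < f (Suc i)" for f :: "nat \<Rightarrow> 'a"
    using finite_height_no_comparable_sequence[OF assms] lift_Suc_mono_less[of f, OF asc] by blast
  then show ?thesis
    by (auto simp: wf_iff_no_infinite_down_chain)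
qed

text \<open>Well-foundedness is applied to the part of \<open>A\<close> below \<open>a\<close>, not
  to \<open>A\<close> itself. An element of \<open>A\<close> below a member of this part is again in
  it, so minimality carries over to \<open>A\<close>.\<close>

lemma minimal_element_below:
  fixes a :: "'a::order"
  assumes fh: "finite_height TYPE('a)" and "a \<in> A"
  obtains m where "m \<in> minimal_elements A" and "m \<le> a"
proof -
  note finite_height_wf_less[OF fh]
  moreover have "a \<in> {x \<in> A. x \<le> a}"
    using \<open>a \<in> A\<close> by simp
  ultimately obtain m where "m \<in> {x \<in> A. x \<le> a}"
    and "\<And>y. (y, m) \<in> {(x, y). x < y} \<Longrightarrow> y \<notin> {x \<in> A. x \<le> a}"
    by (rule wfE_min) blast
  then have "m \<in> minimal_elements A" "m \<le> a"
    unfolding minimal_elements_def by (auto simp: order.order_iff_strict intro: order.strict_trans)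
  then show thesis by (rule that)
qed

lemma maximal_element_above:
  fixes a :: "'a::order"
  assumes fh: "finite_height TYPE('a)" and "a \<in> A"
  obtains m where "m \<in> maximal_elements A" and "a \<le> m"
proof -
  note finite_height_wf_greater[OF fh]
  moreover have "a \<in> {x \<in> A. a \<le> x}"
    using \<open>a \<in> A\<close> by simp
  ultimately obtain m where "m \<in> {x \<in> A. a \<le> x}"
    and "\<And>y. (y, m) \<in> {(x, y). y < x} \<Longrightarrow> y \<notin> {x \<in> A. a \<le> x}"
    by (rule wfE_min) blast
  then have "m \<in> maximal_elements A" "a \<le> m"
    unfolding maximal_elements_def by (auto simp: order.order_iff_strict intro: order.strict_trans)
  then show thesis by (rule that)
qed

section \<open>Extremal bounds of comparable elements; calculus of partial meets and joins\<close>

lemma minimal_upper_bounds_of_le: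
  "y \<le> x \<Longrightarrow> minimal_elements (upper_bounds x y) = {x}"
  by (auto simp: minimal_elements_def upper_bounds_def)

lemma maximal_lower_bounds_of_ge:
  "y \<le> x \<Longrightarrow> maximal_elements (lower_bounds x y) = {y}"
  by (auto simp: maximal_elements_def lower_bounds_def)

lemma is_meet_unique: "is_meet x y z \<Longrightarrow> is_meet x y w \<Longrightarrow> z = w"
  by (auto simp: is_meet_def intro: order.antisym)

lemma is_join_unique: "is_join x y z \<Longrightarrow> is_join x y w \<Longrightarrow> z = w"
  by (auto simp: is_join_def intro: order.antisym)

lemma meet_eqI: "is_meet x y z \<Longrightarrow> meet x y = z"
  unfolding meet_def using is_meet_unique by blast

lemma join_eqI: "is_join x y z \<Longrightarrow> join x y = z"
  unfolding join_def using is_join_unique by blast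

lemma is_meet_meet: "has_meet x y \<Longrightarrow> is_meet x y (meet x y)"
  unfolding has_meet_def using meet_eqI by blast

lemma is_join_join: "has_join x y \<Longrightarrow> is_join x y (join x y)"
  unfolding has_join_def using join_eqI by blast

lemma is_meet_commute: "is_meet x y z \<longleftrightarrow> is_meet y x z"
  by (auto simp: is_meet_def lower_bounds_def)

lemma is_join_commute: "is_join x y z \<longleftrightarrow> is_join y x z"
  by (auto simp: is_join_def upper_bounds_def)

lemma is_meet_top: "is_meet top x (x :: 'a::order_top)"
  by (auto simp: is_meet_def lower_bounds_def)

lemma is_join_bot: "is_join x bot (x :: 'a::order_bot)"
  by (auto simp: is_join_def upper_bounds_def)

lemma is_meet_mono: "is_meet a y u \<Longrightarrow> is_meet b y v \<Longrightarrow> a \<le> b \<Longrightarrow> u \<le> v"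
  by (auto simp: is_meet_def lower_bounds_def intro: order.trans)

lemma is_join_mono: "is_join x a u \<Longrightarrow> is_join x b v \<Longrightarrow> a \<le> b \<Longrightarrow> u \<le> v"
  by (auto simp: is_join_def upper_bounds_def intro: order.trans)

section \<open>The orthomodular laws as a pair of inverse maps\<close>

locale involutive_weakly_orthomodular =
  fixes c :: "'a::{order_bot,order_top} \<Rightarrow> 'a"
  assumes wom: "weakly_orthomodular c"
    and dwom: "dually_weakly_orthomodular c"
    and involutive: "c (c x) = x"
begin

lemma compl_top: "c top = bot"
proof -
  have "is_meet top (c top) bot"
    using wom by (simp add: weakly_orthomodular_def complementation_def)
  with is_meet_top show ?thesis
    by (rule is_meet_unique)
qed

text \<open>As \<open>x\<close> and \<open>c x\<close> join to \<open>top\<close>, they have no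
  other upper bound. This is the source of idempotence.\<close>

lemma minimal_upper_bounds_compl: "minimal_elements (upper_bounds x (c x)) = {top}"
proof -
  have "is_join x (c x) top"
    using wom by (simp add: weakly_orthomodular_def complementation_def)
  then have "upper_bounds x (c x) = {top}"
    by (auto simp: is_join_def top_le)
  then show ?thesis
    by (auto simp: minimal_elements_def)
qed

text \<open>Weak orthomodularity for the pair \<open>c y\<close>, \<open>m\<close>, with
  \<open>c (c y)\<close> replaced by \<open>y\<close>. It provides every meet occurring in
  \<open>om_odot\<close>.\<close>

lemma is_meet_of_above_compl: "c y \<le> m \<Longrightarrow> is_meet m y (meet m y)"
  using wom is_meet_meet[of m y] involutive[of y] unfolding weakly_orthomodular_def by metis

text \<open>One of the two inverse laws: \<open>m\<close> is recovered from its meet with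
  \<open>y\<close>.\<close>

lemma is_join_compl_meet: "c y \<le> m \<Longrightarrow> is_join (c y) (meet m y) m"
  using wom involutive[of y] unfolding weakly_orthomodular_def by metis

lemma is_join_of_below: "l \<le> y \<Longrightarrow> is_join (c y) l (join (c y) l)"
proof -
  assume "l \<le> y"
  then have "has_join (c y) l"
    using dwom by (simp add: dually_weakly_orthomodular_def has_join_def is_join_commute)
  then show ?thesis
    by (rule is_join_join)
qed

text \<open>The other inverse law, from dual weak orthomodularity: \<open>l\<close> is recovered
  from its join with \<open>c y\<close>.\<close>

lemma is_meet_join_compl: "l \<le> y \<Longrightarrow> is_meet (join (c y) l) y l"
proof -
  assume "l \<le> y"
  then have "is_meet y (join l (c y)) l"
    using dwom by (simp add: dually_weakly_orthomodular_def)
  moreover have "join l (c y) = join (c y) l"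
    using is_join_of_below[OF \<open>l \<le> y\<close>] is_join_commute join_eqI by metis
  ultimately show ?thesis
    by (simp add: is_meet_commute)
qed

lemma compl_le_join: "l \<le> y \<Longrightarrow> c y \<le> join (c y) l"
  using is_join_of_below by (auto simp: is_join_def upper_bounds_def)

lemma meet_join_compl: "l \<le> y \<Longrightarrow> meet (join (c y) l) y = l"
  using is_meet_join_compl by (rule meet_eqI)

text \<open>Here \<open>x\<close> is itself the least upper bound of \<open>x\<close> and
  \<open>c y\<close>, so only one meet is formed.\<close>

lemma odot_of_compl_le: "c y \<le> x \<Longrightarrow> om_odot c x y = {meet x y}"
  by (simp add: om_odot_def set_meet_def minimal_upper_bounds_of_le)

lemma imp_of_le: "y \<le> x \<Longrightarrow> om_imp c x y = {join (c x) y}"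
  by (simp add: om_imp_def join_set_def maximal_lower_bounds_of_ge)

lemma imp_bot: "om_imp c x bot = {c x}"
  by (simp add: imp_of_le join_eqI[OF is_join_bot])

lemma odot_idem: "om_odot c x x = {x}"
  by (simp add: om_odot_def set_meet_def minimal_upper_bounds_compl meet_eqI[OF is_meet_top])

lemma odot_top_right: "om_odot c x top = {x}"
proof -
  have "is_meet x top x"
    using is_meet_commute is_meet_top by (rule iffD1)
  then show ?thesis
    by (simp add: odot_of_compl_le compl_top meet_eqI)
qed

lemma odot_top_left: "om_odot c top x = {x}"
  by (simp add: odot_of_compl_le meet_eqI[OF is_meet_top])

section \<open>Adjointness of the two operators\<close>

lemma odot_sq_le_iff:
  assumes fh: "finite_height TYPE('a)"
  shows "sq_le (om_odot c x y) {z} \<longleftrightarrow> sq_le {x} (om_imp c y z)"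
proof
  assume "sq_le (om_odot c x y) {z}"
  then obtain m where m: "x \<le> m" "c y \<le> m" and "meet m y \<le> z"
    by (auto simp: sq_le_def om_odot_def set_meet_def minimal_elements_def upper_bounds_def)
  moreover have "meet m y \<le> y"
    using is_meet_of_above_compl[OF m(2)] by (simp add: is_meet_def lower_bounds_def)
  ultimately have "meet m y \<in> lower_bounds y z"
    by (simp add: lower_bounds_def)
  then obtain l where l: "l \<in> maximal_elements (lower_bounds y z)" and "meet m y \<le> l"
    by (rule maximal_element_above[OF fh])
  from l have "l \<le> y"
    by (simp add: maximal_elements_def lower_bounds_def)
  \<comment> \<open>Since \<open>m\<close> is the join of \<open>c y\<close> and
    \<open>meet m y\<close>, enlarging \<open>meet m y\<close> to \<open>l\<close> yields a bound
    for \<open>m\<close>.\<close>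
  have "m \<le> join (c y) l"
    using is_join_compl_meet[OF m(2)] is_join_of_below[OF \<open>l \<le> y\<close>] \<open>meet m y \<le> l\<close>
    by (rule is_join_mono)
  then show "sq_le {x} (om_imp c y z)"
    using l m(1) by (auto simp: sq_le_def om_imp_def join_set_def intro: order.trans)
next
  assume "sq_le {x} (om_imp c y z)"
  then obtain l where l: "l \<le> y" "l \<le> z" and "x \<le> join (c y) l"
    by (auto simp: sq_le_def om_imp_def join_set_def maximal_elements_def lower_bounds_def)
  \<comment> \<open>This upper bound need not be minimal; finite height supplies a minimal one below
    it.\<close>
  then have "join (c y) l \<in> upper_bounds x (c y)"
    using compl_le_join by (simp add: upper_bounds_def)
  then obtain m where m: "m \<in> minimal_elements (upper_bounds x (c y))"
    and "m \<le> join (c y) l"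
    by (rule minimal_element_below[OF fh])
  from m have "c y \<le> m"
    by (simp add: minimal_elements_def upper_bounds_def)
  \<comment> \<open>Meeting \<open>join (c y) l\<close> with \<open>y\<close> returns
    \<open>l\<close>, so the smaller \<open>m\<close> meets \<open>y\<close> below
    \<open>l\<close>.\<close>
  have "meet m y \<le> l"
    using is_meet_of_above_compl[OF \<open>c y \<le> m\<close>] is_meet_join_compl[OF l(1)]
      \<open>m \<le> join (c y) l\<close>
    by (rule is_meet_mono)
  then show "sq_le (om_odot c x y) {z}"
    using l(2) m by (auto simp: sq_le_def om_odot_def set_meet_def intro: order.trans)
qed

section \<open>Well-definedness, the structure axioms and divisibility\<close>

lemma odot_well_defined:
  assumes fh: "finite_height TYPE('a)"
  shows "om_odot_well_defined c"
  unfolding om_odot_well_defined_def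
proof (intro allI conjI)
  fix x y
  show "set_meet_defined (minimal_elements (upper_bounds x (c y))) y"
    using is_meet_of_above_compl
    by (auto simp: set_meet_defined_def has_meet_def minimal_elements_def upper_bounds_def)
  \<comment> \<open>Non-emptiness: \<open>top\<close> is always an upper bound, and a minimal one
    lies below it.\<close>
  have "top \<in> upper_bounds x (c y)"
    by (simp add: upper_bounds_def)
  then obtain m where "m \<in> minimal_elements (upper_bounds x (c y))"
    by (rule minimal_element_below[OF fh])
  then show "om_odot c x y \<noteq> {}"
    by (auto simp: om_odot_def set_meet_def)
qed

lemma imp_well_defined:
  assumes fh: "finite_height TYPE('a)"
  shows "om_imp_well_defined c"
  unfolding om_imp_well_defined_def
proof (intro allI conjI)
  fix x y
  show "join_set_defined (c x) (maximal_elements (lower_bounds x y))"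
    using is_join_of_below
    by (auto simp: join_set_defined_def has_join_def maximal_elements_def lower_bounds_def)
  have "bot \<in> lower_bounds x y"
    by (simp add: lower_bounds_def)
  then obtain l where "l \<in> maximal_elements (lower_bounds x y)"
    by (rule maximal_element_above[OF fh])
  then show "om_imp c x y \<noteq> {}"
    by (auto simp: om_imp_def join_set_def)
qed

lemma operator_residuated:
  assumes fh: "finite_height TYPE('a)"
  shows "operator_residuated_structure (om_odot c) (om_imp c)"
  unfolding operator_residuated_structure_def
proof (intro conjI allI impI)
  fix x y z
  show "om_odot c x y \<noteq> {}" "om_imp c x y \<noteq> {}"
    using odot_well_defined[OF fh] imp_well_defined[OF fh]
    by (simp_all add: om_odot_well_defined_def om_imp_well_defined_def)
  show "sq_le (om_odot c x y) {z} \<longleftrightarrow> sq_le {x} (om_imp c y z)"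
    by (rule odot_sq_le_iff[OF fh])
  show "om_odot c x top = {x}" "om_odot c top x = {x}"
    by (rule odot_top_right odot_top_left)+
next
  fix x y
  assume "\<forall>a\<in>om_imp c y bot. a \<le> x"
  \<comment> \<open>The set \<open>om_imp c y bot\<close> is the singleton of
    \<open>c y\<close>.\<close>
  then have "c y \<le> x"
    by (simp add: imp_bot)
  then show "has_meet x y" "om_odot c x y = {meet x y}"
    using is_meet_of_above_compl by (auto simp: has_meet_def odot_of_compl_le)
next
  fix x y :: 'a
  assume "y \<le> x"
  \<comment> \<open>Both sides of the equation reduce to the singleton of
    \<open>join (c x) y\<close>.\<close>
  with is_join_of_below[OF this] show "set_join_defined (om_imp c x bot) y"
    "om_imp c x y = set_join (om_imp c x bot) y"
    by (auto simp: imp_bot imp_of_le set_join_defined_def set_join_def has_join_def)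
qed

text \<open>Each element of \<open>om_imp c x y\<close> is \<open>join (c x) l\<close> for a maximal
  common lower bound \<open>l\<close>. It lies above \<open>c x\<close>, so its product with
  \<open>x\<close> is a single meet, which returns \<open>l\<close>. The union over all
  \<open>l\<close> is then the required set.\<close>

lemma om_divisible: "divisible (om_odot c) (om_imp c)"
proof -
  have "om_odot c (join (c x) l) x = {l}" if "l \<le> x" for x l
    using that by (simp add: odot_of_compl_le compl_le_join meet_join_compl)
  then have "om_odot c (join (c x) l) x = {l}"
    if "l \<in> maximal_elements (lower_bounds x y)" for x y l
    using that by (simp add: maximal_elements_def lower_bounds_def)
  then show ?thesis
    by (fastforce simp: divisible_def lift_left_def om_imp_def join_set_def)
qed

end

theorem corollary14:
  fixes c :: "'a::{order_bot,order_top} \<Rightarrow> 'a"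
  assumes "finite_height TYPE('a)"
    and "weakly_orthomodular c"
    and "dually_weakly_orthomodular c"
    and "\<And>x. c (c x) = x"
  shows "om_odot_well_defined c \<and> om_imp_well_defined c \<and>
    operator_residuated_structure (om_odot c) (om_imp c) \<and>
    idempotent_op (om_odot c) \<and>
    divisible (om_odot c) (om_imp c) \<and>
    double_negation_law (om_imp c) \<and>
    (\<forall>x. om_imp c x bot = {c x})"
proof -
  interpret involutive_weakly_orthomodular c
    using assms(2-4) by unfold_locales
  \<comment> \<open>For double negation, \<open>imp_bot\<close> is used twice and produces
    \<open>c (c x)\<close>, which involutivity turns into \<open>x\<close>.\<close>
  show ?thesis
    using odot_well_defined[OF assms(1)] imp_well_defined[OF assms(1)]
      operator_residuated[OF assms(1)] om_divisible
    by (simp add: idempotent_op_def double_negation_law_def lift_left_def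
        odot_idem imp_bot involutive)
qed

end
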